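(* Let $\phi=\tanh$, $\sigma_w\ge0$, $\sigma_b>0$, $p^{(0)}\ge0$, and let $\chi^{(l)}$ be the mean-field squared gradient norm at layer $l$ of a reduced residual network (RRN) with nonlinearity $\phi$. (1) If $\sigma_w=0$, then $\chi^{(m)}=\chi^{(l)}$ for all $l,m$. (2) If $\sigma_w>0$, then for all layers $l\ge m\ge1$, $$\log(\chi^{(m)}/\chi^{(l)})=\mathcal A(\sqrt l-\sqrt m)+\mathcal B(\log l-\log m)+O(1),$$ where $\mathcal A=\frac43\sqrt{\frac2\pi}\,\sigma_w$ and $\mathcal B=\frac4{3\pi}-\sigma_w^2\frac4{9\pi}$, and the $O(1)$ is bounded by a constant independent of $l$ and $m$.
   Context: Put $\mathrm V f(q)=\mathbb E[f(z)^2]$, $z\sim\mathcal N(0,q)$, and $\dot\phi=\phi'$. An RRN has layers $x^{(l)}_i=\phi(h^{(l)}_i)+x^{(l-1)}_i$, $h^{(l)}_i=\sum_j w^{(l)}_{ij}x^{(l-1)}_j+b^{(l)}_i$ with $w^{(l)}_{ij}\sim\mathcal N(0,\sigma_w^2/N)$, $b^{(l)}_i\sim\mathcal N(0,\sigma_b^2)$ i.i.d. Its mean-field ($N\to\infty$) length quantities are determined by $p^{(0)}$ and, for $l\ge1$, $q^{(l)}=\sigma_w^2p^{(l-1)}+\sigma_b^2$, $p^{(l)}=\mathrm V\phi(q^{(l)})+p^{(l-1)}$. For a loss $E$, the mean-field gradient quantity $\chi^{(l)}=\langle(\partial E/\partial x^{(l)}_1)^2\rangle$ (computed with backward weights independent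 of the forward ones) is determined by its positive value at the last layer and the backward recurrence $$\chi^{(l-1)}=(\sigma_w^2\,\mathrm V\dot\phi(q^{(l)})+1)\,\chi^{(l)}.$$ *)

theory Defs
  imports "HOL-Probability.Probability"
begin

text \<open>The law \<open>N(0,q)\<close>, where \<open>q \<ge> 0\<close> is the variance (\<open>normal_density\<close> takes the standard
  deviation).\<close>

definition centered_normal :: "real \<Rightarrow> real measure" where
  "centered_normal q =
     (if q = 0 then return borel 0 else density lborel (\<lambda>x. ennreal (normal_density 0 (sqrt q) x)))"

definition V :: "(real \<Rightarrow> real) \<Rightarrow> real \<Rightarrow> real" where
  "V f q = (LINT z|centered_normal q. (f z)\<^sup>2)"

text \<open>Mean-field length quantities of a reduced residual network. Layer \<open>0\<close> has no
  preactivation: \<open>rrn_q \<dots> l\<close> is meaningful only for \<open>l \<ge> 1\<close>.\<close>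

primrec rrn_p :: "(real \<Rightarrow> real) \<Rightarrow> real \<Rightarrow> real \<Rightarrow> real \<Rightarrow> nat \<Rightarrow> real" where
  "rrn_p \<phi> \<sigma>w \<sigma>b p0 0 = p0"
| "rrn_p \<phi> \<sigma>w \<sigma>b p0 (Suc l) =
     V \<phi> (\<sigma>w\<^sup>2 * rrn_p \<phi> \<sigma>w \<sigma>b p0 l + \<sigma>b\<^sup>2) + rrn_p \<phi> \<sigma>w \<sigma>b p0 l"

definition rrn_q :: "(real \<Rightarrow> real) \<Rightarrow> real \<Rightarrow> real \<Rightarrow> real \<Rightarrow> nat \<Rightarrow> real" where
  "rrn_q \<phi> \<sigma>w \<sigma>b p0 l = \<sigma>w\<^sup>2 * rrn_p \<phi> \<sigma>w \<sigma>b p0 (l - 1) + \<sigma>b\<^sup>2"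

lemma rrn_p_rec:
  assumes "l \<ge> 1"
  shows "rrn_p \<phi> \<sigma>w \<sigma>b p0 l = V \<phi> (rrn_q \<phi> \<sigma>w \<sigma>b p0 l) + rrn_p \<phi> \<sigma>w \<sigma>b p0 (l - 1)"
  using assms by (cases l) (simp_all add: rrn_q_def)

text \<open>\<open>chi l\<close>, for \<open>l \<le> L\<close>, is the mean-field squared gradient norm at layer \<open>l\<close> of a network of
  depth \<open>L\<close>; the positive value \<open>chi L\<close> comes from the loss and is otherwise arbitrary, and values
  beyond \<open>L\<close> are unconstrained.\<close>

definition rrn_grad ::
  "(real \<Rightarrow> real) \<Rightarrow> real \<Rightarrow> real \<Rightarrow> real \<Rightarrow> nat \<Rightarrow> (nat \<Rightarrow> real) \<Rightarrow> bool" where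
  "rrn_grad \<phi> \<sigma>w \<sigma>b p0 L chi \<longleftrightarrow>
     chi L > 0 \<and>
     (\<forall>l\<in>{1..L}. chi (l - 1) = (\<sigma>w\<^sup>2 * V (deriv \<phi>) (rrn_q \<phi> \<sigma>w \<sigma>b p0 l) + 1) * chi l)"

end

theory Submission
  imports Defs "HOL-Real_Asymp.Real_Asymp"
begin

text \<open>Let \<open>Q l = \<sigma>w\<^sup>2 * p l + \<sigma>b\<^sup>2\<close>, the preactivation variance of layer \<open>l + 1\<close>, and \<open>u = sqrt Q\<close>. Since
  \<open>tanh' = sech\<^sup>2\<close> and \<open>tanh'\<^sup>2 = sech\<^sup>4\<close> have integrals \<open>2\<close> and \<open>4/3\<close>, one has
  \<open>V tanh Q = 1 - c / u + O(1 / u ^ 3)\<close> and \<open>V tanh' Q = (2/3) c / u + O(1 / u ^ 3)\<close> with \<open>c = sqrt (2/\<pi>)\<close>.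
  Up to \<open>O(1 / u ^ 3)\<close>, the increment \<open>ln (1 + \<sigma>w\<^sup>2 * V tanh' Q)\<close> of \<open>- ln \<chi>\<close> is therefore a fixed linear
  combination of the increments of \<open>u\<close> and of \<open>ln Q\<close>, so the sum telescopes. As \<open>Q\<close> grows linearly the
  errors are summable, and it is enough to know \<open>u l = \<sigma>w * sqrt l + O(1)\<close> and \<open>ln (Q l) = ln l + O(1)\<close>:
  the logarithmic term in the expansion of \<open>Q\<close> plays no role.\<close>

section \<open>Gaussian averages of integrable functions\<close>

lemma V_eq_integral:
  assumes "q > 0" and [measurable]: "f \<in> borel_measurable borel"
  shows "V f q = (\<integral>x. normal_density 0 (sqrt q) x * (f x)\<^sup>2 \<partial>lborel)"
  using assms(1) unfolding V_def centered_normal_def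
  by (simp add: integral_density normal_density_nonneg)

lemma normal_density_mult_le:
  assumes "q > 0" "y \<ge> 0"
  shows "normal_density 0 (sqrt q) x * y \<le> y / sqrt (2 * pi * q)"
proof -
  have "exp (- (x\<^sup>2 / (2 * q))) * y \<le> y"
    using assms by (intro mult_left_le_one_le) auto
  then show ?thesis using assms by (simp add: normal_density_def divide_right_mono)
qed

lemma gaussian_integral_integrable:
  assumes q: "q > 0" and [measurable]: "f \<in> borel_measurable borel" and f0: "\<And>x. 0 \<le> f x"
    and f: "integrable lborel f"
  shows "integrable lborel (\<lambda>x. normal_density 0 (sqrt q) x * f x)"
proof (rule Bochner_Integration.integrable_bound)
  show "integrable lborel (\<lambda>x. f x / sqrt (2 * pi * q))" using f by simp
  show "AE x in lborel. norm (normal_density 0 (sqrt q) x * f x) \<le> norm (f x / sqrt (2 * pi * q))"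
    using normal_density_mult_le[OF q f0] q f0 by (simp add: abs_mult normal_density_nonneg)
qed simp

text \<open>The exponential factor of the density lies between \<open>1 - x^2 / (2 * q)\<close> and
  1. Replacing it by 1 therefore costs at most the second moment of \<open>f\<close> over
  \<open>2 * q\<close>, times the prefactor: an error of order
  \<open>1 / sqrt q ^ 3\<close>.\<close>

lemma gaussian_integral_bounds:
  fixes f :: "real \<Rightarrow> real"
  assumes q: "q > 0" and [measurable]: "f \<in> borel_measurable borel" and f0: "\<And>x. 0 \<le> f x"
    and f: "integrable lborel f" and f2: "integrable lborel (\<lambda>x. x\<^sup>2 * f x)"
  shows "(\<integral>x. normal_density 0 (sqrt q) x * f x \<partial>lborel) \<le> (\<integral>x. f x \<partial>lborel) / sqrt (2 * pi * q)"
    and "(\<integral>x. f x \<partial>lborel) / sqrt (2 * pi * q) - (\<integral>x. x\<^sup>2 * f x \<partial>lborel) / (2 * q * sqrt (2 * pi * q))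
       \<le> (\<integral>x. normal_density 0 (sqrt q) x * f x \<partial>lborel)"
proof -
  note int = gaussian_integral_integrable[OF q assms(2) f0 f]
  have 2: "f x / sqrt (2 * pi * q) - x\<^sup>2 * f x / (2 * q * sqrt (2 * pi * q)) \<le> normal_density 0 (sqrt q) x * f x" for x
  proof -
    have "(1 - x\<^sup>2 / (2 * q)) * f x \<le> exp (- (x\<^sup>2 / (2 * q))) * f x"
      using f0[of x] exp_ge_add_one_self[of "- (x\<^sup>2 / (2 * q))"] by (intro mult_right_mono) auto
    then have "(1 - x\<^sup>2 / (2 * q)) * f x / sqrt (2 * pi * q) \<le> exp (- (x\<^sup>2 / (2 * q))) * f x / sqrt (2 * pi * q)"
      using q by (intro divide_right_mono) auto
    then show ?thesis using q by (simp add: normal_density_def field_simps)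
  qed
  show "(\<integral>x. normal_density 0 (sqrt q) x * f x \<partial>lborel) \<le> (\<integral>x. f x \<partial>lborel) / sqrt (2 * pi * q)"
    using integral_mono[OF int _ normal_density_mult_le[OF q f0]] f by simp
  show "(\<integral>x. f x \<partial>lborel) / sqrt (2 * pi * q) - (\<integral>x. x\<^sup>2 * f x \<partial>lborel) / (2 * q * sqrt (2 * pi * q))
       \<le> (\<integral>x. normal_density 0 (sqrt q) x * f x \<partial>lborel)"
    using integral_mono[OF _ int 2] f f2 by simp
qed

section \<open>Integrals of powers of sech over the real line\<close>

text \<open>Since \<open>f\<close> has constant sign, the two finite limits of the antiderivative
  give integrability together with the value.\<close>

lemma real_line_FTC_nonneg:
  fixes f F :: "real \<Rightarrow> real"
  assumes F: "\<And>x. (F has_real_derivative f x) (at x)" and f: "\<And>x. isCont f x" "\<And>x. 0 \<le> f x"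
    and "(F \<longlongrightarrow> A) at_bot" "(F \<longlongrightarrow> B) at_top"
  shows "integrable lborel f" "(\<integral>x. f x \<partial>lborel) = B - A"
proof -
  have "set_integrable lborel (einterval (-\<infinity>) \<infinity>) f" "(LBINT x=-\<infinity>..\<infinity>. f x) = B - A"
    using assms by (intro interval_integral_FTC_nonneg[where F=F];
      simp add: tendsto_compose_filtermap at_right_MInf at_left_PInf filterlim_filtermap o_def)+
  then show "integrable lborel f" "(\<integral>x. f x \<partial>lborel) = B - A"
    by (simp_all add: set_integrable_def interval_integral_to_infinity_eq interval_lebesgue_integral_def set_lebesgue_integral_def)
qed

lemma tanh_real_square_less_1: "(tanh (x::real))\<^sup>2 < 1"
  using tanh_real_bounds[of x] by (simp add: abs_square_less_1 abs_less_iff)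

lemma isCont_tanh_real [continuous_intros]: "isCont (tanh :: real \<Rightarrow> real) x"
  by (rule isCont_tanh) auto

text \<open>The antiderivatives are \<open>tanh\<close> and \<open>tanh - tanh^3 / 3\<close>, which
  increase by 2 and 4/3 in total.\<close>

lemma
  shows integrable_sech2: "integrable lborel (\<lambda>x::real. 1 - (tanh x)\<^sup>2)"
    and integral_sech2: "(\<integral>x. 1 - (tanh x)\<^sup>2 \<partial>lborel) = (2::real)"
    and integrable_sech4: "integrable lborel (\<lambda>x::real. (1 - (tanh x)\<^sup>2)\<^sup>2)"
    and integral_sech4: "(\<integral>x. (1 - (tanh x)\<^sup>2)\<^sup>2 \<partial>lborel) = (4 / 3 :: real)"
proof -
  have *: "integrable lborel (\<lambda>x::real. 1 - (tanh x)\<^sup>2)" "(\<integral>x. 1 - (tanh x)\<^sup>2 \<partial>lborel) = 1 - (-1::real)"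
    by (rule real_line_FTC_nonneg[where F=tanh];
        auto intro!: derivative_eq_intros continuous_intros tanh_real_at_top tanh_real_at_bot
           simp: less_imp_le[OF tanh_real_square_less_1])+
  have "((\<lambda>x. tanh x - tanh x ^ 3 / 3) \<longlongrightarrow> 1 - 1 ^ 3 / (3::real)) at_top"
       "((\<lambda>x. tanh x - tanh x ^ 3 / 3) \<longlongrightarrow> - 1 - (-1) ^ 3 / (3::real)) at_bot"
    by (intro tendsto_intros tanh_real_at_top tanh_real_at_bot; simp)+
  moreover have "((\<lambda>x. tanh x - tanh x ^ 3 / 3) has_real_derivative (1 - (tanh x)\<^sup>2)\<^sup>2) (at x)" for x :: real
    by (auto intro!: derivative_eq_intros simp: power2_eq_square) (simp add: algebra_simps)
  moreover have "isCont (\<lambda>x. (1 - (tanh x)\<^sup>2)\<^sup>2) x" for x :: real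
    by (intro continuous_intros)
  ultimately have **: "integrable lborel (\<lambda>x::real. (1 - (tanh x)\<^sup>2)\<^sup>2)"
      "(\<integral>x. (1 - (tanh x)\<^sup>2)\<^sup>2 \<partial>lborel) = (1 - 1 ^ 3 / (3::real)) - (- 1 - (-1) ^ 3 / (3::real))"
    using real_line_FTC_nonneg[where f="\<lambda>x. (1 - (tanh x)\<^sup>2)\<^sup>2" and F="\<lambda>x. tanh x - tanh x ^ 3 / 3"]
    by (blast intro: zero_le_power2)+
  show "integrable lborel (\<lambda>x::real. 1 - (tanh x)\<^sup>2)" "(\<integral>x. 1 - (tanh x)\<^sup>2 \<partial>lborel) = (2::real)"
    "integrable lborel (\<lambda>x::real. (1 - (tanh x)\<^sup>2)\<^sup>2)"
    "(\<integral>x. (1 - (tanh x)\<^sup>2)\<^sup>2 \<partial>lborel) = (4 / 3 :: real)"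
    using * ** by simp_all
qed

text \<open>A majorant that stays integrable after multiplication by \<open>x^2\<close>. From
  \<open>\<bar>y\<bar> \<le> \<bar>sinh y\<bar>\<close> at \<open>y = x / 2\<close> and
  \<open>cosh x = 1 + 2 * (sinh (x / 2))^2\<close> one gets
  \<open>2 * cosh x \<ge> 2 + x^2\<close>.\<close>

lemma sech2_le: "1 - (tanh (x::real))\<^sup>2 \<le> 4 / (1 + x\<^sup>2)\<^sup>2"
proof -
  have "0 \<le> sinh y - y" if "0 \<le> y" for y :: real
  proof -
    have "sinh 0 - (0::real) \<le> sinh y - y"
      by (rule DERIV_nonneg_imp_nondecreasing[OF that])
         (auto intro!: exI derivative_eq_intros simp: cosh_real_ge_1)
    then show ?thesis by simp
  qed
  from this[of "\<bar>y\<bar>" for y] have "\<bar>y\<bar> \<le> \<bar>sinh y\<bar>" for y :: real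
    by simp
  then have "(x/2)\<^sup>2 \<le> (sinh (x/2))\<^sup>2" by (simp add: abs_le_square_iff)
  then have "1 + x\<^sup>2 \<le> 2 * cosh x"
    using cosh_double[of "x/2"] by (simp add: cosh_square_eq power_divide)
  then have "(1 + x\<^sup>2)\<^sup>2 \<le> (2 * cosh x)\<^sup>2" by (intro power_mono) auto
  moreover have "0 < (1 + x\<^sup>2)\<^sup>2"
    by (intro zero_less_power add_pos_nonneg) auto
  ultimately have "4 / (2 * cosh x)\<^sup>2 \<le> 4 / (1 + x\<^sup>2)\<^sup>2"
    by (intro divide_left_mono mult_pos_pos) auto
  moreover have "1 - (tanh x)\<^sup>2 = 4 / (2 * cosh x)\<^sup>2"
    using cosh_square_eq[of x] by (simp add: tanh_def divide_simps add_nonneg_eq_0_iff)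
  ultimately show ?thesis by simp
qed

lemma integrable_square_sech2: "integrable lborel (\<lambda>x::real. x\<^sup>2 * (1 - (tanh x)\<^sup>2))"
proof (rule Bochner_Integration.integrable_bound)
  show "integrable lborel (\<lambda>x::real. 4 * inverse (1 + x\<^sup>2))"
    using integrable_inverse_1_plus_square by (simp add: set_integrable_def)
  have "x\<^sup>2 * (1 - (tanh x)\<^sup>2) \<le> 4 * inverse (1 + x\<^sup>2)" for x :: real
  proof -
    have "x\<^sup>2 * (1 - (tanh x)\<^sup>2) \<le> (1 + x\<^sup>2) * (4 / (1 + x\<^sup>2)\<^sup>2)"
      using sech2_le[of x] tanh_real_square_less_1[of x] by (intro mult_mono) auto
    also have "\<dots> = 4 * inverse (1 + x\<^sup>2)"
      by (simp add: power2_eq_square[of "1 + x\<^sup>2"] divide_inverse add_nonneg_eq_0_iff)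
    finally show ?thesis .
  qed
  then show "AE x in lborel. norm ((x::real)\<^sup>2 * (1 - (tanh x)\<^sup>2)) \<le> norm (4 * inverse (1 + x\<^sup>2))"
    using less_imp_le[OF tanh_real_square_less_1]
    by (auto simp: abs_mult)
qed (auto intro!: borel_measurable_continuous_onI continuous_at_imp_continuous_on continuous_intros)

lemma borel_measurable_tanh_real [measurable]: "(tanh :: real \<Rightarrow> real) \<in> borel_measurable borel"
  by (intro borel_measurable_continuous_onI continuous_at_imp_continuous_on ballI isCont_tanh_real)

section \<open>Expansions of \<open>V tanh\<close> and \<open>V (deriv tanh)\<close> for large
  variance\<close>

text \<open>The square of \<open>tanh\<close> tends to 1 at both ends and is not integrable over the
  line. Its complement is, so the Gaussian bounds apply to the complement.\<close>

lemma V_tanh_eq: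
  assumes "q > 0"
  shows "V tanh q = 1 - (\<integral>x. normal_density 0 (sqrt q) x * (1 - (tanh x)\<^sup>2) \<partial>lborel)"
proof -
  have int: "integrable lborel (\<lambda>x. normal_density 0 (sqrt q) x * (1 - (tanh x)\<^sup>2))"
    using assms less_imp_le[OF tanh_real_square_less_1]
    by (intro gaussian_integral_integrable integrable_sech2) auto
  have "V tanh q = (\<integral>x. normal_density 0 (sqrt q) x - normal_density 0 (sqrt q) x * (1 - (tanh x)\<^sup>2) \<partial>lborel)"
    using assms by (subst V_eq_integral) (auto simp: algebra_simps)
  also have "\<dots> = 1 - (\<integral>x. normal_density 0 (sqrt q) x * (1 - (tanh x)\<^sup>2) \<partial>lborel)"
    using int assms by simp
  finally show ?thesis .
qed

lemma deriv_tanh_real: "deriv tanh = (\<lambda>x::real. 1 - (tanh x)\<^sup>2)"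
  by (intro ext DERIV_imp_deriv) (auto intro!: derivative_eq_intros)

lemma gaussian_normalisation:
  assumes "q > 0"
  shows "a / sqrt (2 * pi * q) = a / 2 * sqrt (2 / pi) / sqrt q"
    and "a / (2 * q * sqrt (2 * pi * q)) = a / 4 * sqrt (2 / pi) / sqrt q ^ 3"
proof -
  have "sqrt 2 * sqrt 2 = 2" by simp
  then have "1 / sqrt (2 * pi * q) = 1 / 2 * sqrt (2 / pi) / sqrt q"
    using assms by (simp add: real_sqrt_mult real_sqrt_divide field_simps)
  moreover have "sqrt q ^ 3 = q * sqrt q"
    using assms by (simp add: power3_eq_cube)
  ultimately show "a / sqrt (2 * pi * q) = a / 2 * sqrt (2 / pi) / sqrt q"
    "a / (2 * q * sqrt (2 * pi * q)) = a / 4 * sqrt (2 / pi) / sqrt q ^ 3"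
    using assms by (auto simp: field_simps)
qed

text \<open>Passing to the complement swaps the two Gaussian bounds, so the error term sits in the
  upper one. The witness \<open>k\<close> is a multiple of the second moment of
  \<open>sech^2\<close>, independent of \<open>q\<close>.\<close>

lemma V_tanh_bounds:
  obtains k where
    "\<And>q. q > 0 \<Longrightarrow> 1 - sqrt (2 / pi) / sqrt q \<le> V tanh q"
    "\<And>q. q > 0 \<Longrightarrow> V tanh q \<le> 1 - sqrt (2 / pi) / sqrt q + k / sqrt q ^ 3"
proof
  fix q :: real assume q: "q > 0"
  have D0: "0 \<le> 1 - (tanh x)\<^sup>2" for x :: real
    using tanh_real_square_less_1[of x] by simp
  note b = gaussian_integral_bounds[OF q _ D0 integrable_sech2 integrable_square_sech2,
      unfolded integral_sech2 gaussian_normalisation[OF q] V_tanh_eq[OF q, symmetric]]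
  show "1 - sqrt (2 / pi) / sqrt q \<le> V tanh q"
    using b(1) by (simp add: V_tanh_eq[OF q])
  show "V tanh q \<le> 1 - sqrt (2 / pi) / sqrt q
      + ((\<integral>x. x\<^sup>2 * (1 - (tanh x)\<^sup>2) \<partial>lborel) / 4 * sqrt (2 / pi)) / sqrt q ^ 3"
    using b(2) by (simp add: V_tanh_eq[OF q])
qed

text \<open>The integrand is now \<open>sech^4\<close>, of total mass 4/3, whose half is the leading
  coefficient. Its second moment is finite by comparison with \<open>sech^2\<close> and enters
  \<open>k\<close> with a minus sign.\<close>

lemma V_deriv_tanh_bounds:
  obtains k where
    "\<And>q. q > 0 \<Longrightarrow> V (deriv tanh) q \<le> 2 / 3 * sqrt (2 / pi) / sqrt q"
    "\<And>q. q > 0 \<Longrightarrow> 2 / 3 * sqrt (2 / pi) / sqrt q + k / sqrt q ^ 3 \<le> V (deriv tanh) q"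
proof
  fix q :: real assume q: "q > 0"
  have D: "0 \<le> 1 - (tanh x)\<^sup>2" "1 - (tanh x)\<^sup>2 \<le> 1" for x :: real
    using tanh_real_square_less_1[of x] by simp_all
  have int: "integrable lborel (\<lambda>x::real. x\<^sup>2 * (1 - (tanh x)\<^sup>2)\<^sup>2)"
  proof (rule Bochner_Integration.integrable_bound[OF integrable_square_sech2])
    have "(1 - (tanh x)\<^sup>2)\<^sup>2 \<le> 1 - (tanh x)\<^sup>2" for x :: real
      using D[of x] by (simp add: power2_eq_square mult_left_le)
    then show "AE x in lborel. norm ((x::real)\<^sup>2 * (1 - (tanh x)\<^sup>2)\<^sup>2) \<le> norm (x\<^sup>2 * (1 - (tanh x)\<^sup>2))"
      using D by (intro AE_I2) (auto simp: abs_mult intro!: mult_left_mono)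
  qed auto
  have V: "V (deriv tanh) q = (\<integral>x. normal_density 0 (sqrt q) x * (1 - (tanh x)\<^sup>2)\<^sup>2 \<partial>lborel)"
    unfolding deriv_tanh_real using q by (intro V_eq_integral) auto
  note b = gaussian_integral_bounds[OF q _ zero_le_power2 integrable_sech4 int,
      unfolded integral_sech4 gaussian_normalisation[OF q] V[symmetric]]
  show "V (deriv tanh) q \<le> 2 / 3 * sqrt (2 / pi) / sqrt q"
    using b(1) by simp
  show "2 / 3 * sqrt (2 / pi) / sqrt q
      + (- (\<integral>x. x\<^sup>2 * (1 - (tanh x)\<^sup>2)\<^sup>2 \<partial>lborel) / 4 * sqrt (2 / pi)) / sqrt q ^ 3 \<le> V (deriv tanh) q"
    using b(2) by simp
qed

section \<open>Uniform bounds on \<open>V tanh\<close>\<close>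

lemma V_tanh_le_1: "q > 0 \<Longrightarrow> V tanh q \<le> 1"
  using less_imp_le[OF tanh_real_square_less_1]
  by (subst V_tanh_eq) (auto intro!: integral_nonneg_AE AE_I2 simp: normal_density_nonneg)

lemma V_nonneg: "0 \<le> V f q"
  unfolding V_def by (intro integral_nonneg_AE AE_I2) auto

text \<open>For \<open>q \<ge> q0\<close> the density of \<open>N(0,q)\<close> dominates \<open>sqrt (q0 / q)\<close> times that of \<open>N(0,q0)\<close>, so
  \<open>V tanh q \<ge> \<kappa> / sqrt q\<close>. A positive combination with \<open>V tanh q \<ge> 1 - c / sqrt q\<close> cancels the
  terms in \<open>1 / sqrt q\<close>.\<close>

lemma V_tanh_uniformly_positive:
  assumes "q0 > 0"
  obtains a where "a > 0" "\<And>q. q \<ge> q0 \<Longrightarrow> a \<le> V tanh q"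
proof
  define \<kappa> where "\<kappa> = sqrt q0 * V tanh q0"
  define c where "c = sqrt (2 / pi)"
  have c: "c > 0" by (simp add: c_def)
  have int: "integrable lborel (\<lambda>x. normal_density 0 (sqrt q) x * (tanh x)\<^sup>2)" if "q > 0" for q
    by (rule Bochner_Integration.integrable_bound[OF integrable_normal_density[of "sqrt q" 0]])
       (use that less_imp_le[OF tanh_real_square_less_1] in
        \<open>auto intro!: AE_I2 mult_left_le simp: abs_mult normal_density_nonneg\<close>)
  have lower: "\<kappa> / sqrt q \<le> V tanh q" if "q \<ge> q0" for q
  proof -
    have q: "q > 0" using assms that by simp
    have "sqrt q0 / sqrt q * (normal_density 0 (sqrt q0) x * (tanh x)\<^sup>2) \<le> normal_density 0 (sqrt q) x * (tanh x)\<^sup>2" for x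
    proof -
      have "exp (- (x\<^sup>2 / (2 * q0))) \<le> exp (- (x\<^sup>2 / (2 * q)))"
        using that assms by (auto intro!: divide_left_mono)
      then have "sqrt q0 / sqrt q * normal_density 0 (sqrt q0) x \<le> normal_density 0 (sqrt q) x"
        using assms q by (simp add: normal_density_def real_sqrt_mult field_simps)
      then show ?thesis
        by (metis (no_types) mult.assoc mult_right_mono zero_le_power2)
    qed
    then have "(\<integral>x. sqrt q0 / sqrt q * (normal_density 0 (sqrt q0) x * (tanh x)\<^sup>2) \<partial>lborel) \<le> V tanh q"
      unfolding V_eq_integral[OF q borel_measurable_tanh_real]
      using q assms by (intro integral_mono integrable_mult_right int)
    then show ?thesis
      using assms by (simp add: \<kappa>_def V_eq_integral)
  qed
  have "\<kappa> > 0"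
  proof -
    \<comment> \<open>Otherwise \<open>tanh\<close> would vanish almost everywhere, and the line
      would have the measure of a single point.\<close>
    have "V tanh q0 \<noteq> 0"
    proof
      assume "V tanh q0 = 0"
      then have "AE x in lborel. normal_density 0 (sqrt q0) x * (tanh x)\<^sup>2 = 0"
        using assms int[OF assms]
        by (subst (asm) V_eq_integral, simp, simp, subst (asm) integral_nonneg_eq_0_iff_AE)
           (auto simp: normal_density_nonneg)
      then have "AE x in lborel. x = (0::real)"
        using normal_density_pos[of "sqrt q0" 0] assms by (auto simp: less_le)
      then have "emeasure lborel (space lborel :: real set) = emeasure lborel {0::real}"
        by (intro emeasure_eq_AE) auto
      then show False by simp
    qed
    then show ?thesis using V_nonneg[of tanh q0] assms by (simp add: \<kappa>_def less_le)
  qed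
  then show "\<kappa> / (\<kappa> + c) > 0" using c by simp
  fix q assume q: "q \<ge> q0"
  have "1 - c / sqrt q \<le> V tanh q"
    using V_tanh_bounds q assms unfolding c_def by (metis order_less_le_trans)
  then have "\<kappa> * (1 - c / sqrt q) \<le> \<kappa> * V tanh q"
    using \<open>\<kappa> > 0\<close> by (intro mult_left_mono) auto
  moreover have "c * (\<kappa> / sqrt q) \<le> c * V tanh q"
    using lower[OF q] c by (intro mult_left_mono) auto
  ultimately have "\<kappa> \<le> (\<kappa> + c) * V tanh q" by (simp add: algebra_simps)
  then show "\<kappa> / (\<kappa> + c) \<le> V tanh q"
    using \<open>\<kappa> > 0\<close> c by (simp add: field_simps)
qed

section \<open>Expansion of a single layer\<close>

text \<open>Since \<open>\<bar>f - m\<bar> \<le> \<bar>lo - m\<bar> + \<bar>hi - m\<bar>\<close>, a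
  function known only through two explicit bounds inherits their common expansion.\<close>

lemma bigo_sandwich:
  fixes f g lo hi m :: "real \<Rightarrow> real"
  assumes "(\<lambda>x. lo x - m x) \<in> O[F](g)" "(\<lambda>x. hi x - m x) \<in> O[F](g)"
    and "\<forall>\<^sub>F x in F. lo x \<le> f x \<and> f x \<le> hi x"
  shows "(\<lambda>x. f x - m x) \<in> O[F](g)"
proof (rule landau_o.big_trans)
  show "(\<lambda>x. f x - m x) \<in> O[F](\<lambda>x. \<bar>lo x - m x\<bar> + \<bar>hi x - m x\<bar>)"
    by (rule bigoI[of _ 1], rule eventually_mono[OF assms(3)]) auto
  show "(\<lambda>x. \<bar>lo x - m x\<bar> + \<bar>hi x - m x\<bar>) \<in> O[F](g)"
    using assms(1,2) by (intro sum_in_bigo) simp_all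
qed

text \<open>Eliminating \<open>s\<^sup>2 / u\<close> and \<open>s\<^sup>2 / u\<^sup>2\<close> between the expansions
  \<open>\<Delta> sqrt q = s\<^sup>2 / (2 * u) - c * s\<^sup>2 / (2 * u\<^sup>2) + \<dots>\<close>, \<open>\<Delta> ln q = s\<^sup>2 / u\<^sup>2 + \<dots>\<close> and
  \<open>ln (1 + s\<^sup>2 * w') = d * s\<^sup>2 / u - d\<^sup>2 * s\<^sup>4 / (2 * u\<^sup>2) + \<dots>\<close>, where \<open>q = u\<^sup>2\<close>, produces the
  coefficients.\<close>

lemma one_step_expansion:
  fixes w w' :: "real \<Rightarrow> real" and s c d :: real
  assumes s: "s > 0" and d: "d > 0"
    and w: "\<And>u. u > 0 \<Longrightarrow> 1 - c / u \<le> w u" "\<And>u. u > 0 \<Longrightarrow> w u \<le> 1 - c / u + k / u ^ 3"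
    and w': "\<And>u. u > 0 \<Longrightarrow> w' u \<le> d / u" "\<And>u. u > 0 \<Longrightarrow> d / u + k' / u ^ 3 \<le> w' u"
  shows "(\<lambda>u. ln (1 + s\<^sup>2 * w' u)
            - (2 * d * (sqrt (u\<^sup>2 + s\<^sup>2 * w u) - u)
               + (d * c - d\<^sup>2 * s\<^sup>2 / 2) * (ln (u\<^sup>2 + s\<^sup>2 * w u) - ln (u\<^sup>2)))) \<in> O(\<lambda>u. 1 / u ^ 3)"
proof -
  have pos: "\<forall>\<^sub>F u in at_top. u > (0::real)" by (rule eventually_gt_at_top)
  \<comment> \<open>The free \<open>x\<close> is later 0 or the error constant, so that one
    expansion covers both the lower and the upper bound; likewise below.\<close>
  have sqrt_exp: "(\<lambda>u. sqrt (u\<^sup>2 + s\<^sup>2 * (1 - c / u + x / u ^ 3)) - (u + s\<^sup>2 / (2 * u) - s\<^sup>2 * c / (2 * u\<^sup>2)))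
      \<in> O(\<lambda>u. 1 / u ^ 3)" for x
    using s by real_asymp
  have ln_exp: "(\<lambda>u. ln (u\<^sup>2 + s\<^sup>2 * (1 - c / u + x / u ^ 3)) - (ln (u\<^sup>2) + s\<^sup>2 / u\<^sup>2))
      \<in> O(\<lambda>u. 1 / u ^ 3)" for x
    using s by real_asymp
  have ln1_exp': "(\<lambda>u. ln (1 + e / u + y / u ^ 3) - (e / u - e * e / (2 * u\<^sup>2))) \<in> O(\<lambda>u. 1 / u ^ 3)"
    if "e > 0" for e y :: real
    using that by real_asymp
  have ln1_exp: "(\<lambda>u. ln (1 + s\<^sup>2 * (d / u + x / u ^ 3)) - (d * s\<^sup>2 / u - d\<^sup>2 * s ^ 4 / (2 * u\<^sup>2)))
      \<in> O(\<lambda>u. 1 / u ^ 3)" for x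
    using ln1_exp'[of "d * s\<^sup>2" "s\<^sup>2 * x"] s d
    by (simp add: algebra_simps power2_eq_square power4_eq_xxxx)
  have 1: "(\<lambda>u. sqrt (u\<^sup>2 + s\<^sup>2 * w u) - (u + s\<^sup>2 / (2 * u) - s\<^sup>2 * c / (2 * u\<^sup>2))) \<in> O(\<lambda>u. 1 / u ^ 3)"
    by (rule bigo_sandwich[OF sqrt_exp[of 0] sqrt_exp[of k]], rule eventually_mono[OF pos])
       (use w in \<open>simp add: mult_left_mono\<close>)
  \<comment> \<open>Monotonicity of \<open>ln\<close> requires the smaller argument to be
    positive.\<close>
  have "\<forall>\<^sub>F u in at_top. u\<^sup>2 + s\<^sup>2 * (1 - c / u + 0 / u ^ 3) > 0"
    using s by real_asymp
  then have "\<forall>\<^sub>F u in at_top. ln (u\<^sup>2 + s\<^sup>2 * (1 - c / u + 0 / u ^ 3)) \<le> ln (u\<^sup>2 + s\<^sup>2 * w u)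
      \<and> ln (u\<^sup>2 + s\<^sup>2 * w u) \<le> ln (u\<^sup>2 + s\<^sup>2 * (1 - c / u + k / u ^ 3))"
    using pos
  proof eventually_elim
    case (elim u)
    have "s\<^sup>2 * (1 - c / u + 0 / u ^ 3) \<le> s\<^sup>2 * w u" "s\<^sup>2 * w u \<le> s\<^sup>2 * (1 - c / u + k / u ^ 3)"
      using w[OF elim(2)] by (auto intro!: mult_left_mono)
    then show ?case using elim(1) by (intro conjI ln_mono) linarith+
  qed
  then have 2: "(\<lambda>u. ln (u\<^sup>2 + s\<^sup>2 * w u) - (ln (u\<^sup>2) + s\<^sup>2 / u\<^sup>2)) \<in> O(\<lambda>u. 1 / u ^ 3)"
    by (rule bigo_sandwich[OF ln_exp[of 0] ln_exp[of k]])
  have "\<forall>\<^sub>F u in at_top. 1 + s\<^sup>2 * (d / u + k' / u ^ 3) > 0"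
    using s d by real_asymp
  then have "\<forall>\<^sub>F u in at_top. ln (1 + s\<^sup>2 * (d / u + k' / u ^ 3)) \<le> ln (1 + s\<^sup>2 * w' u)
      \<and> ln (1 + s\<^sup>2 * w' u) \<le> ln (1 + s\<^sup>2 * (d / u + 0 / u ^ 3))"
    using pos
  proof eventually_elim
    case (elim u)
    have "s\<^sup>2 * (d / u + k' / u ^ 3) \<le> s\<^sup>2 * w' u" "s\<^sup>2 * w' u \<le> s\<^sup>2 * (d / u + 0 / u ^ 3)"
      using w'[OF elim(2)] by (intro mult_left_mono; simp)+
    then show ?case using elim(1) by (intro conjI ln_mono) linarith+
  qed
  then have 3: "(\<lambda>u. ln (1 + s\<^sup>2 * w' u) - (d * s\<^sup>2 / u - d\<^sup>2 * s ^ 4 / (2 * u\<^sup>2))) \<in> O(\<lambda>u. 1 / u ^ 3)"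
    by (rule bigo_sandwich[OF ln1_exp[of k'] ln1_exp[of 0]])
  \<comment> \<open>The factor 0 is a separate case because the coefficient \<open>b\<close> below
    can vanish.\<close>
  have cmult: "(\<lambda>u. y * f u) \<in> O(g)" if "f \<in> O(g)" for y and f g :: "real \<Rightarrow> real"
    using that by (cases "y = 0") simp_all
  define b where "b = d * c - d\<^sup>2 * s\<^sup>2 / 2"
  \<comment> \<open>In this combination the terms in \<open>1 / u\<close> cancel by the factor
    \<open>2 * d\<close>, those in \<open>1 / u^2\<close> by the choice of \<open>b\<close>.\<close>
  have "(\<lambda>u. (ln (1 + s\<^sup>2 * w' u) - (d * s\<^sup>2 / u - d\<^sup>2 * s ^ 4 / (2 * u\<^sup>2)))
      - 2 * d * (sqrt (u\<^sup>2 + s\<^sup>2 * w u) - (u + s\<^sup>2 / (2 * u) - s\<^sup>2 * c / (2 * u\<^sup>2)))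
      - b * (ln (u\<^sup>2 + s\<^sup>2 * w u) - (ln (u\<^sup>2) + s\<^sup>2 / u\<^sup>2))) \<in> O(\<lambda>u. 1 / u ^ 3)"
    by (intro sum_in_bigo cmult 1 2 3)
  also have "?this \<longleftrightarrow> ?thesis"
    unfolding b_def
    by (intro landau_o.big.in_cong eventually_mono[OF pos])
       (simp add: field_simps power2_eq_square power4_eq_xxxx)
  finally show ?thesis .
qed

section \<open>Growth of the preactivation variance\<close>

text \<open>The bounds \<open>a \<le> w n \<le> 1\<close> give linear growth, which settles the
  logarithm. Fed back into \<open>1 - c / sqrt (Q n)\<close>, linear growth shows a loss of order
  \<open>1 / sqrt n\<close> per step, hence \<open>Q n = s^2 * n + O(sqrt n)\<close>.\<close>

lemma sqrt_recursion_asymptotics: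
  fixes Q w :: "nat \<Rightarrow> real"
  assumes s: "s > 0" and c: "c \<ge> 0" and a: "a > 0" and Q0: "Q 0 \<ge> 0"
    and Q: "\<And>n. Q (Suc n) = Q n + s\<^sup>2 * w n"
    and w: "\<And>n. a \<le> w n" "\<And>n. w n \<le> 1" "\<And>n. n \<ge> 1 \<Longrightarrow> 1 - c / sqrt (Q n) \<le> w n"
  shows "s\<^sup>2 * a * real n \<le> Q n"
    and "\<exists>C. \<forall>n\<ge>1. \<bar>sqrt (Q n) - s * sqrt (real n)\<bar> \<le> C"
    and "\<exists>C. \<forall>n\<ge>1. \<bar>ln (Q n) - ln (real n)\<bar> \<le> C"
proof -
  have lower: "s\<^sup>2 * a * real n \<le> Q n" for n
  proof (induction n)
    case (Suc n)
    have "s\<^sup>2 * a \<le> s\<^sup>2 * w n" using w(1) by (intro mult_left_mono) auto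
    with Suc show ?case by (simp add: Q algebra_simps)
  qed (use Q0 in simp)
  have upper: "Q n \<le> Q 0 + s\<^sup>2 * real n" for n
  proof (induction n)
    case (Suc n)
    have "s\<^sup>2 * w n \<le> s\<^sup>2 * 1" using w(2) by (intro mult_left_mono) auto
    with Suc show ?case by (simp add: Q algebra_simps)
  qed simp
  \<comment> \<open>The first summand pays for the accumulated losses; the second makes the claim at
    \<open>n = 1\<close> follow from \<open>Q 1 \<ge> 0\<close>.\<close>
  define K where "K = 3 * s * c / sqrt a + s\<^sup>2"
  have K0: "K \<ge> 0" using s c a by (simp add: K_def)
  have lower2: "s\<^sup>2 * real n - K * sqrt (real n) \<le> Q n" if "n \<ge> 1" for n
    using that
  proof (induction n rule: nat_induct_at_least)
    case base
    have "0 \<le> Q 1" using lower[of 1] s a by (intro order_trans[OF _ lower]) auto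
    moreover have "3 * s * c / sqrt a \<ge> 0" using s c a by simp
    ultimately show ?case by (simp add: K_def)
  next
    case (Suc n)
    define r where "r = sqrt (real n)"
    define r' where "r' = sqrt (real (Suc n))"
    have r: "r \<ge> 1" "r ^ 2 = real n" "r' ^ 2 = r ^ 2 + 1" "r' \<ge> 0"
      using Suc(1) by (simp_all add: r_def r'_def)
    have "r' \<le> 2 * r"
      by (rule power2_le_imp_le) (use r one_le_power[of r 2] in \<open>simp_all add: power_mult_distrib\<close>)
    have "1 = (r' - r) * (r' + r)" using r(3) by (simp add: algebra_simps power2_eq_square)
    moreover have "r' \<ge> r" by (simp add: r_def r'_def)
    moreover have "(r' - r) * (r' + r) \<le> (r' - r) * (3 * r)"
      using \<open>r' \<ge> r\<close> \<open>r' \<le> 2 * r\<close> by (intro mult_left_mono) auto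
    ultimately have "1 \<le> (r' - r) * (3 * r)" by simp
    \<comment> \<open>The loss of order \<open>1 / r\<close> is thus dominated by an increment of
      the square root, and the bound telescopes.\<close>
    then have gap: "1 / r \<le> 3 * (r' - r)" using r by (simp add: field_simps)
    have "s * sqrt a * r \<le> sqrt (Q n)"
      using lower[of n] s by (intro real_le_rsqrt) (simp add: power_mult_distrib r a less_imp_le)
    then have "s\<^sup>2 * (c / sqrt (Q n)) \<le> s\<^sup>2 * (c / (s * sqrt a * r))"
      using s c a r less_le_trans[OF _ \<open>s * sqrt a * r \<le> sqrt (Q n)\<close>, of 0]
      by (intro mult_left_mono divide_left_mono mult_pos_pos) auto
    also have "\<dots> = s * c / sqrt a * (1 / r)" using s by (simp add: power2_eq_square)
    also have "\<dots> \<le> s * c / sqrt a * (3 * (r' - r))"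
      using gap s c a by (intro mult_left_mono) auto
    also have "\<dots> = 3 * s * c / sqrt a * (r' - r)" by simp
    also have "\<dots> \<le> K * (r' - r)"
      using \<open>r' \<ge> r\<close> by (intro mult_right_mono) (auto simp: K_def)
    finally have "s\<^sup>2 * (c / sqrt (Q n)) \<le> K * (r' - r)" .
    moreover have "s\<^sup>2 * (1 - c / sqrt (Q n)) \<le> s\<^sup>2 * w n"
      using w(3)[of n] Suc(1) by (intro mult_left_mono) auto
    ultimately have "s\<^sup>2 * real n - K * r + s\<^sup>2 - K * (r' - r) \<le> Q n + s\<^sup>2 * w n"
      using Suc(2) unfolding r_def[symmetric] by (simp add: algebra_simps)
    then show ?case unfolding Q r'_def[symmetric] by (simp add: algebra_simps)
  qed
  show "s\<^sup>2 * a * real n \<le> Q n" by (rule lower)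
  have "\<bar>sqrt (Q n) - s * sqrt (real n)\<bar> \<le> (K + Q 0) / s" if n: "n \<ge> 1" for n
  proof -
    have r: "sqrt (real n) \<ge> 1" using n by simp
    have Qn: "Q n \<ge> 0" using lower[of n] s a by (meson order_trans mult_nonneg_nonneg of_nat_0_le_iff zero_le_power2 less_imp_le)
    \<comment> \<open>As \<open>n \<ge> 1\<close>, the constant \<open>Q 0\<close> of the upper
      bound is absorbed into a multiple of \<open>sqrt n\<close>.\<close>
    have "Q 0 * 1 \<le> Q 0 * sqrt (real n)" using Q0 r by (intro mult_left_mono)
    moreover have "K * sqrt (real n) \<ge> 0" "Q 0 * sqrt (real n) \<ge> 0" using K0 Q0 by simp_all
    ultimately have "\<bar>Q n - s\<^sup>2 * real n\<bar> \<le> (K + Q 0) * sqrt (real n)"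
      using upper[of n] lower2[OF n] Q0 by (simp add: algebra_simps abs_le_iff)
    \<comment> \<open>Dividing by the conjugate factor, at least \<open>s * sqrt n\<close>, turns
      the error \<open>O(sqrt n)\<close> in \<open>Q n\<close> into \<open>O(1)\<close> in its
      root.\<close>
    moreover have "Q n - s\<^sup>2 * real n = (sqrt (Q n) - s * sqrt (real n)) * (sqrt (Q n) + s * sqrt (real n))"
      using Qn by (simp add: algebra_simps power2_eq_square)
    moreover have "\<bar>sqrt (Q n) - s * sqrt (real n)\<bar> * (s * sqrt (real n))
        \<le> \<bar>sqrt (Q n) - s * sqrt (real n)\<bar> * \<bar>sqrt (Q n) + s * sqrt (real n)\<bar>"
      using Qn s by (intro mult_left_mono) auto
    ultimately have "\<bar>sqrt (Q n) - s * sqrt (real n)\<bar> * s * sqrt (real n) \<le> (K + Q 0) * sqrt (real n)"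
      by (simp add: abs_mult mult.assoc)
    then have "\<bar>sqrt (Q n) - s * sqrt (real n)\<bar> * s \<le> K + Q 0"
      by (rule mult_right_le_imp_le) (use r in linarith)
    then show ?thesis using s by (simp add: field_simps)
  qed
  then show "\<exists>C. \<forall>n\<ge>1. \<bar>sqrt (Q n) - s * sqrt (real n)\<bar> \<le> C" by blast
  have "\<bar>ln (Q n) - ln (real n)\<bar> \<le> max \<bar>ln (Q 0 + s\<^sup>2)\<bar> \<bar>ln (s\<^sup>2 * a)\<bar>" if n: "n \<ge> 1" for n
  proof -
    have pos: "0 < s\<^sup>2 * a" "0 < Q 0 + s\<^sup>2" using s a Q0 by (auto simp: add_nonneg_pos)
    have "Q 0 * 1 \<le> Q 0 * real n" using Q0 n by (intro mult_left_mono) auto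
    then have "Q n \<le> (Q 0 + s\<^sup>2) * real n" using upper[of n] by (simp add: algebra_simps)
    moreover have "0 < s\<^sup>2 * a * real n" using pos n by simp
    ultimately have "ln (Q n) \<le> ln ((Q 0 + s\<^sup>2) * real n)" "ln (s\<^sup>2 * a * real n) \<le> ln (Q n)"
      using lower[of n] by (auto intro!: ln_mono)
    then have "ln (Q n) \<le> ln (Q 0 + s\<^sup>2) + ln (real n)" "ln (s\<^sup>2 * a) + ln (real n) \<le> ln (Q n)"
      using pos n by (simp_all add: ln_mult_pos del: ln_mult)
    then show ?thesis by linarith
  qed
  then show "\<exists>C. \<forall>n\<ge>1. \<bar>ln (Q n) - ln (real n)\<bar> \<le> C" by blast
qed

section \<open>The gradient ratio as a sum over layers\<close>

text \<open>The logarithm of the backward recurrence telescopes. The factor leading from layer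
  \<open>j + 1\<close> to layer \<open>j\<close> involves \<open>rrn_q\<close> at
  \<open>j + 1\<close>, hence \<open>rrn_p\<close> at \<open>j\<close>, so the sum runs over
  \<open>m..<l\<close>.\<close>

lemma rrn_grad_ln_ratio:
  assumes chi: "rrn_grad \<phi> \<sigma>w \<sigma>b p0 L chi" and l: "l \<le> L" "m \<le> l"
  shows "ln (chi m / chi l)
    = (\<Sum>j=m..<l. ln (1 + \<sigma>w\<^sup>2 * V (deriv \<phi>) (\<sigma>w\<^sup>2 * rrn_p \<phi> \<sigma>w \<sigma>b p0 j + \<sigma>b\<^sup>2)))"
proof -
  define x where "x j = 1 + \<sigma>w\<^sup>2 * V (deriv \<phi>) (\<sigma>w\<^sup>2 * rrn_p \<phi> \<sigma>w \<sigma>b p0 j + \<sigma>b\<^sup>2)" for j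
  have x: "x j > 0" for j
    using V_nonneg by (auto simp: x_def intro!: add_pos_nonneg)
  have step: "chi j = x j * chi (Suc j)" if "j < L" for j
  proof -
    have "Suc j \<in> {1..L}" using that by simp
    then have "chi (Suc j - 1) = (\<sigma>w\<^sup>2 * V (deriv \<phi>) (rrn_q \<phi> \<sigma>w \<sigma>b p0 (Suc j)) + 1) * chi (Suc j)"
      using chi unfolding rrn_grad_def by blast
    then show ?thesis by (simp add: x_def rrn_q_def add.commute)
  qed
  \<comment> \<open>Positivity passes down from layer \<open>L\<close> because every factor
    \<open>x j\<close> is positive.\<close>
  have pos: "chi j > 0" if "j \<le> L" for j
    using that
  proof (induction j rule: inc_induct)
    case base
    then show ?case using chi by (simp add: rrn_grad_def)
  next
    case (step j)
    then show ?case using \<open>j < L \<Longrightarrow> chi j = x j * chi (Suc j)\<close> x by simp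
  qed
  have "ln (chi m / chi l) = ln (chi m) - ln (chi l)"
    using pos[of m] pos[of l] l by (simp add: ln_div)
  also have "\<dots> = - (\<Sum>j=m..<l. ln (chi (Suc j)) - ln (chi j))"
    using l by (subst sum_Suc_diff') auto
  also have "\<dots> = (\<Sum>j=m..<l. ln (x j))"
    unfolding sum_negf[symmetric]
    using l x pos by (intro sum.cong) (auto simp: step ln_mult_pos)
  finally show ?thesis by (simp add: x_def)
qed

text \<open>The exponent is that of \<open>1 / u ^ 3\<close> with \<open>u\<close> of order
  \<open>sqrt n\<close>. Absolute summability bounds all blocks of terms at once by the full sum of
  absolute values.\<close>

lemma bounded_partial_sums:
  fixes f :: "nat \<Rightarrow> real"
  assumes "f \<in> O(\<lambda>n. real n powr (-3/2))"
  shows "\<exists>C. \<forall>m l. \<bar>\<Sum>j=m..<l. f j\<bar> \<le> C"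
proof (intro exI allI)
  fix m l :: nat
  have summable: "summable (\<lambda>n. \<bar>f n\<bar>)"
  proof (rule summable_comparison_test_bigo)
    show "summable (\<lambda>n. norm (real n powr (-3/2)))" by (simp add: summable_real_powr_iff)
    show "(\<lambda>n. \<bar>f n\<bar>) \<in> O(\<lambda>n. real n powr (-3/2))" using assms by simp
  qed
  have "\<bar>\<Sum>j=m..<l. f j\<bar> \<le> (\<Sum>j=m..<l. \<bar>f j\<bar>)" by (rule sum_abs)
  also have "\<dots> \<le> (\<Sum>j. \<bar>f j\<bar>)" by (rule sum_le_suminf[OF summable]) auto
  finally show "\<bar>\<Sum>j=m..<l. f j\<bar> \<le> (\<Sum>j. \<bar>f j\<bar>)" .
qed

section \<open>Assembling the asymptotics\<close>

text \<open>The error terms depend on the forward recursion alone, so \<open>C\<close> can be fixed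
  before the depth \<open>L\<close> and the gradient \<open>chi\<close>.\<close>

lemma rrn_tanh_log_gradient_asymptotics:
  fixes \<sigma>w \<sigma>b p0 :: real
  assumes s: "\<sigma>w > 0" and b: "\<sigma>b > 0" and p0: "p0 \<ge> 0"
  shows "\<exists>C. \<forall>L chi. rrn_grad tanh \<sigma>w \<sigma>b p0 L chi \<longrightarrow>
               (\<forall>l m. 1 \<le> m \<longrightarrow> m \<le> l \<longrightarrow> l \<le> L \<longrightarrow>
                  \<bar>ln (chi m / chi l)
                    - ((4 / 3 * sqrt (2 / pi) * \<sigma>w) * (sqrt (real l) - sqrt (real m))
                       + (4 / (3 * pi) - \<sigma>w\<^sup>2 * (4 / (9 * pi))) * (ln (real l) - ln (real m)))\<bar>
                  \<le> C)"
proof -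
  define c where "c = sqrt (2 / pi)"
  define d where "d = 2 / 3 * c"
  define B where "B = d * c - d\<^sup>2 * \<sigma>w\<^sup>2 / 2"
  define Q where "Q n = \<sigma>w\<^sup>2 * rrn_p tanh \<sigma>w \<sigma>b p0 n + \<sigma>b\<^sup>2" for n
  have c0: "c > 0" and d0: "d > 0" by (simp_all add: c_def d_def)
  have c2: "c\<^sup>2 = 2 / pi" by (simp add: c_def)
  have B: "B = 4 / (3 * pi) - \<sigma>w\<^sup>2 * (4 / (9 * pi))"
  proof -
    have "B = 2 / 3 * c\<^sup>2 - 2 / 9 * c\<^sup>2 * \<sigma>w\<^sup>2"
      by (simp add: B_def d_def power2_eq_square algebra_simps)
    then show ?thesis by (simp add: c2)
  qed
  have Q_Suc: "Q (Suc n) = Q n + \<sigma>w\<^sup>2 * V tanh (Q n)" for n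
    by (simp add: Q_def algebra_simps)
  \<comment> \<open>This supplies both \<open>q > 0\<close> for the expansions and the threshold
    \<open>q0\<close> for the uniform lower bound \<open>a\<close>.\<close>
  have Q_ge: "\<sigma>b\<^sup>2 \<le> Q n" for n
  proof (induction n)
    case (Suc n)
    then show ?case using V_nonneg[of tanh "Q n"] by (simp add: Q_Suc add_increasing2)
  qed (use p0 in \<open>simp add: Q_def\<close>)
  have Q_pos: "Q n > 0" for n
    using less_le_trans[OF _ Q_ge, of 0] b by simp
  obtain k where V1: "\<And>q. q > 0 \<Longrightarrow> 1 - c / sqrt q \<le> V tanh q"
      "\<And>q. q > 0 \<Longrightarrow> V tanh q \<le> 1 - c / sqrt q + k / sqrt q ^ 3"
    using V_tanh_bounds unfolding c_def by blast
  obtain k' where V2: "\<And>q. q > 0 \<Longrightarrow> V (deriv tanh) q \<le> d / sqrt q"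
      "\<And>q. q > 0 \<Longrightarrow> d / sqrt q + k' / sqrt q ^ 3 \<le> V (deriv tanh) q"
    using V_deriv_tanh_bounds unfolding c_def d_def by blast
  obtain a where a: "a > 0" "\<And>q. q \<ge> \<sigma>b\<^sup>2 \<Longrightarrow> a \<le> V tanh q"
    using V_tanh_uniformly_positive[of "\<sigma>b\<^sup>2"] b by auto
  note asym = sqrt_recursion_asymptotics[of \<sigma>w c a Q "\<lambda>n. V tanh (Q n)", OF s less_imp_le[OF c0] a(1)
      less_imp_le[OF Q_pos] Q_Suc a(2)[OF Q_ge] V_tanh_le_1[OF Q_pos] V1(1)[OF Q_pos]]
  obtain C1 where C1: "\<And>n. n \<ge> 1 \<Longrightarrow> \<bar>sqrt (Q n) - \<sigma>w * sqrt (real n)\<bar> \<le> C1"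
    using asym(2) by blast
  obtain C2 where C2: "\<And>n. n \<ge> 1 \<Longrightarrow> \<bar>ln (Q n) - ln (real n)\<bar> \<le> C2"
    using asym(3) by blast
  define R where "R j = ln (1 + \<sigma>w\<^sup>2 * V (deriv tanh) (Q j))
      - (2 * d * (sqrt (Q (Suc j)) - sqrt (Q j)) + B * (ln (Q (Suc j)) - ln (Q j)))" for j
  \<comment> \<open>The one-step expansion holds as \<open>u\<close> tends to infinity; divergence
    permits the substitution \<open>u = sqrt (Q n)\<close>.\<close>
  have "filterlim (\<lambda>n. sqrt (Q n)) at_top sequentially"
  proof (rule filterlim_at_top_mono)
    show "filterlim (\<lambda>n. sqrt (\<sigma>w\<^sup>2 * a * real n)) at_top sequentially"
      using s a(1) by real_asymp
    show "\<forall>\<^sub>F n in sequentially. sqrt (\<sigma>w\<^sup>2 * a * real n) \<le> sqrt (Q n)"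
      using asym(1) by simp
  qed
  moreover have "1 - c / u \<le> V tanh (u\<^sup>2)" "V tanh (u\<^sup>2) \<le> 1 - c / u + k / u ^ 3"
      "V (deriv tanh) (u\<^sup>2) \<le> d / u" "d / u + k' / u ^ 3 \<le> V (deriv tanh) (u\<^sup>2)" if "u > 0" for u
    using that V1[of "u\<^sup>2"] V2[of "u\<^sup>2"] by simp_all
  note one_step_expansion[OF s d0 this]
  ultimately have "(\<lambda>n. ln (1 + \<sigma>w\<^sup>2 * V (deriv tanh) ((sqrt (Q n))\<^sup>2))
      - (2 * d * (sqrt ((sqrt (Q n))\<^sup>2 + \<sigma>w\<^sup>2 * V tanh ((sqrt (Q n))\<^sup>2)) - sqrt (Q n))
         + (d * c - d\<^sup>2 * \<sigma>w\<^sup>2 / 2) * (ln ((sqrt (Q n))\<^sup>2 + \<sigma>w\<^sup>2 * V tanh ((sqrt (Q n))\<^sup>2)) - ln ((sqrt (Q n))\<^sup>2))))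
    \<in> O(\<lambda>n. 1 / sqrt (Q n) ^ 3)"
    by (rule landau_o.big.compose[rotated])
  then have "R \<in> O(\<lambda>n. 1 / sqrt (Q n) ^ 3)"
    using Q_pos[THEN less_imp_le] by (simp add: R_def[abs_def] Q_Suc B_def)
  also have "(\<lambda>n. 1 / sqrt (Q n) ^ 3) \<in> O(\<lambda>n. 1 / sqrt (\<sigma>w\<^sup>2 * a * real n) ^ 3)"
  proof (rule bigoI[of _ 1], rule eventually_mono[OF eventually_gt_at_top[of 0]])
    fix n :: nat assume "0 < n"
    then show "norm (1 / sqrt (Q n) ^ 3) \<le> 1 * norm (1 / sqrt (\<sigma>w\<^sup>2 * a * real n) ^ 3)"
      using s a(1) Q_pos[of n] asym(1)[of n] by (auto intro!: divide_left_mono power_mono mult_pos_pos)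
  qed
  also have "(\<lambda>n. 1 / sqrt (\<sigma>w\<^sup>2 * a * real n) ^ 3) \<in> O(\<lambda>n. real n powr (-3/2))"
    using s a(1) by real_asymp
  finally obtain C where C: "\<And>m l. \<bar>\<Sum>j=m..<l. R j\<bar> \<le> C"
    using bounded_partial_sums by blast
  show ?thesis
  proof (intro exI allI impI)
    fix L chi l m
    assume chi: "rrn_grad tanh \<sigma>w \<sigma>b p0 L chi" and lm: "1 \<le> m" "m \<le> l" "l \<le> L"
    have "ln (chi m / chi l)
        = (\<Sum>j=m..<l. R j + 2 * d * (sqrt (Q (Suc j)) - sqrt (Q j)) + B * (ln (Q (Suc j)) - ln (Q j)))"
      using rrn_grad_ln_ratio[OF chi lm(3,2)] by (simp add: R_def Q_def)
    also have "\<dots> = (\<Sum>j=m..<l. R j) + 2 * d * (sqrt (Q l) - sqrt (Q m)) + B * (ln (Q l) - ln (Q m))"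
      using lm by (simp add: sum.distrib sum_distrib_left[symmetric] sum_Suc_diff'[of m l "\<lambda>j. sqrt (Q j)"]
          sum_Suc_diff'[of m l "\<lambda>j. ln (Q j)"])
    \<comment> \<open>The comparison terms in \<open>sqrt\<close> and \<open>ln\<close> of
      \<open>l\<close> and \<open>m\<close> are inserted, leaving three differences that are bounded
      separately by \<open>C\<close>, \<open>C1\<close> and \<open>C2\<close>.\<close>
    finally have eq: "ln (chi m / chi l)
          - (2 * d * \<sigma>w * (sqrt (real l) - sqrt (real m)) + B * (ln (real l) - ln (real m)))
        = (\<Sum>j=m..<l. R j)
          + 2 * d * ((sqrt (Q l) - \<sigma>w * sqrt (real l)) - (sqrt (Q m) - \<sigma>w * sqrt (real m)))
          + B * ((ln (Q l) - ln (real l)) - (ln (Q m) - ln (real m)))"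
      by (simp add: algebra_simps)
    have 1: "\<bar>2 * d * ((sqrt (Q l) - \<sigma>w * sqrt (real l)) - (sqrt (Q m) - \<sigma>w * sqrt (real m)))\<bar> \<le> 2 * d * (2 * C1)"
      unfolding abs_mult using d0 C1[of l] C1[of m] lm by (intro mult_mono) auto
    have 2: "\<bar>B * ((ln (Q l) - ln (real l)) - (ln (Q m) - ln (real m)))\<bar> \<le> \<bar>B\<bar> * (2 * C2)"
      unfolding abs_mult using C2[of l] C2[of m] lm by (intro mult_left_mono) auto
    have "2 * d * \<sigma>w = 4 / 3 * sqrt (2 / pi) * \<sigma>w" by (simp add: d_def c_def)
    note eq[unfolded this]
    with 1 2 C[of m l]
    show "\<bar>ln (chi m / chi l)
        - ((4 / 3 * sqrt (2 / pi) * \<sigma>w) * (sqrt (real l) - sqrt (real m))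
           + (4 / (3 * pi) - \<sigma>w\<^sup>2 * (4 / (9 * pi))) * (ln (real l) - ln (real m)))\<bar>
      \<le> C + 2 * d * (2 * C1) + \<bar>B\<bar> * (2 * C2)"
      unfolding B[symmetric] by linarith
  qed
qed

theorem theoremB6:
  fixes \<sigma>w \<sigma>b p0 :: real
  assumes "\<sigma>w \<ge> 0" and "\<sigma>b > 0" and "p0 \<ge> 0"
  shows "(\<sigma>w = 0 \<longrightarrow>
            (\<forall>L chi. rrn_grad tanh \<sigma>w \<sigma>b p0 L chi \<longrightarrow>
               (\<forall>l m. l \<le> L \<longrightarrow> m \<le> L \<longrightarrow> chi m = chi l)))
       \<and> (\<sigma>w > 0 \<longrightarrow>
            (\<exists>C. \<forall>L chi. rrn_grad tanh \<sigma>w \<sigma>b p0 L chi \<longrightarrow>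
               (\<forall>l m. 1 \<le> m \<longrightarrow> m \<le> l \<longrightarrow> l \<le> L \<longrightarrow>
                  \<bar>ln (chi m / chi l)
                    - ((4 / 3 * sqrt (2 / pi) * \<sigma>w) * (sqrt (real l) - sqrt (real m))
                       + (4 / (3 * pi) - \<sigma>w\<^sup>2 * (4 / (9 * pi))) * (ln (real l) - ln (real m)))\<bar>
                  \<le> C)))"
proof (intro conjI impI)
  assume \<sigma>w: "\<sigma>w = 0"
  \<comment> \<open>For \<open>\<sigma>w = 0\<close> the backward factor is 1, so descending from
    layer \<open>L\<close> changes nothing.\<close>
  have "chi j = chi L" if "rrn_grad tanh \<sigma>w \<sigma>b p0 L chi" "j \<le> L" for L chi j
    using that(2)
  proof (induction j rule: inc_induct)
    case (step j)
    have "chi (Suc j - 1) = chi (Suc j)"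
    proof -
      have "Suc j \<in> {1..L}" using step(2) by simp
      then show ?thesis using that(1) \<sigma>w unfolding rrn_grad_def by fastforce
    qed
    then show ?case using step by simp
  qed simp
  then show "\<forall>L chi. rrn_grad tanh \<sigma>w \<sigma>b p0 L chi \<longrightarrow> (\<forall>l m. l \<le> L \<longrightarrow> m \<le> L \<longrightarrow> chi m = chi l)"
    by metis
qed (use rrn_tanh_log_gradient_asymptotics assms in blast)

end
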